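(* Let $T$ be a locally finite triangulation of $\mathbb{R}^2$ in half-edge representation (as described in the context). Then for every target point $p\in\mathbb{R}^2$ and every initial half-edge $e_{\mathrm{init}}$ of $T$, the (non-deterministic) oriented distance walk from $e_{\mathrm{init}}$ towards $p$ terminates after finitely many iterations (for every sequence of choices made in tie cases), i.e. it reaches a half-edge $e$ with $p\in\mathrm{face}(e)$.
   Context: $T=(V,F,E)$ is a tiling of $\mathbb{R}^2$ by non-degenerate closed triangles meeting edge-to-edge. $T$ is locally finite if for every disc in $\mathbb{R}^2$ only finitely many edges (vertices, faces) of $T$ intersect that disc. Each edge is represented by two half-edges (twins). A half-edge $e$ goes from vertex $e_1$ to vertex $e_2$; $\mathrm{inv}(e)$ is its twin (from $e_2$ to $e_1$); $\mathrm{face}(e)$ is the triangle lying to the left of $e$ (the half-edges of a face are oriented counterclockwise); $\mathrm{next}(e)$ and $\mathrm{prev}(e)$ are the next and previous half-edges of $\mathrm{face}(e)$ in its counterclockwise winding order, so $\mathrm{next}(\mathrm{next}(e))=\mathrm{prev}(e)$. "Left/right of $e$" refers to the directed line from $e_1$ to $e_2$. Oriented distance: for a half-edge $e$ and a point $p$ not on the segment $e_1e_2$, let $e_p$ be the point of the segment $e_1e_2$ closest to $p$, $d$ the Euclidean distance $|p-e_p|$, and $\alpha$ the angle at $e_p$ between the segment $e_1e_2$ and the segment $e_p p$ (i.e. the angle $\angle q\,e_p\,p$ for any point $q\neq e_p$ of the segment $e_1e_2$; thus $\alpha=\pi/2$ if $e_p$ is an interior point of the segment, and $\alpha\ge\pi/2$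 always). Write $\mathrm{od}(e,p)=[d,\alpha]$. Order such pairs lexicographically: $[d,\alpha]<[d',\alpha']$ iff $d<d'$, or $d=d'$ and $\alpha<\alpha'$. Oriented distance walk (non-deterministic version), with current half-edge $e$, initially $e=e_{\mathrm{init}}$: 1. If $p$ lies strictly to the right of $e$, set $e\leftarrow\mathrm{inv}(e)$. 2. While $p\notin\mathrm{face}(e)$: 3. let $l=\mathrm{inv}(\mathrm{next}(e))$ and $r=\mathrm{inv}(\mathrm{prev}(e))$; 4. if $\mathrm{od}(l,p)<\mathrm{od}(r,p)$ set $e\leftarrow l$; if $\mathrm{od}(r,p)<\mathrm{od}(l,p)$ set $e\leftarrow r$; otherwise set $e$ to either $l$ or $r$ (arbitrary choice). *)

theory Defs
  imports "HOL-Analysis.Analysis"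
begin

section \<open>Triangulations of the plane\<close>

type_synonym point = "real ^ 2"

definition closed_triangle :: "point set \<Rightarrow> bool" where
  "closed_triangle t \<longleftrightarrow> (\<exists>a b c. \<not> collinear {a, b, c} \<and> t = convex hull {a, b, c})"

text \<open>A tiling is given by its set of faces (closed triangles); its vertices and edges are
  those of the faces.\<close>

definition vertices :: "point set set \<Rightarrow> point set" where
  "vertices T = {v. \<exists>t\<in>T. v extreme_point_of t}"

definition edges :: "point set set \<Rightarrow> point set set" where
  "edges T = {s. \<exists>t\<in>T. s edge_of t}"

definition edge_to_edge :: "point set set \<Rightarrow> bool" where
  "edge_to_edge T \<longleftrightarrow> (\<forall>s\<in>T. \<forall>t\<in>T. s \<noteq> t \<longrightarrow>
     s \<inter> t = {} \<or>
     (\<exists>v. v extreme_point_of s \<and> v extreme_point_of t \<and> s \<inter> t = {v}) \<or>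
     (s \<inter> t) edge_of s \<and> (s \<inter> t) edge_of t)"

definition plane_triangulation :: "point set set \<Rightarrow> bool" where
  "plane_triangulation T \<longleftrightarrow> (\<forall>t\<in>T. closed_triangle t) \<and> \<Union>T = UNIV \<and> edge_to_edge T"

definition locally_finite :: "point set set \<Rightarrow> bool" where
  "locally_finite T \<longleftrightarrow> (\<forall>x r.
     finite {v \<in> vertices T. v \<in> cball x r} \<and>
     finite {s \<in> edges T. s \<inter> cball x r \<noteq> {}} \<and>
     finite {t \<in> T. t \<inter> cball x r \<noteq> {}})"


section \<open>Half-edges\<close>

text \<open>A half-edge is the ordered pair of its start and end vertex.\<close>

type_synonym half_edge = "point \<times> point"

definition half_edges :: "point set set \<Rightarrow> half_edge set" where
  "half_edges T = {e. closed_segment (fst e) (snd e) \<in> edges T}"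

text \<open>The determinant of \<open>(e\<^sub>2 - e\<^sub>1, p - e\<^sub>1)\<close>: positive iff \<open>p\<close> is strictly to the left
  of the directed line from \<open>e\<^sub>1\<close> to \<open>e\<^sub>2\<close>, negative iff strictly to the right.\<close>

definition side :: "half_edge \<Rightarrow> point \<Rightarrow> real" where
  "side e p =
     (snd e $ 1 - fst e $ 1) * (p $ 2 - fst e $ 2) - (snd e $ 2 - fst e $ 2) * (p $ 1 - fst e $ 1)"

definition strictly_right :: "half_edge \<Rightarrow> point \<Rightarrow> bool" where
  "strictly_right e p \<longleftrightarrow> side e p < 0"

definition inv_he :: "half_edge \<Rightarrow> half_edge" where
  "inv_he e = (snd e, fst e)"

definition face_he :: "point set set \<Rightarrow> half_edge \<Rightarrow> point set" where
  "face_he T e =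
     (THE t. t \<in> T \<and> closed_segment (fst e) (snd e) edge_of t \<and> (\<forall>x\<in>t. \<not> strictly_right e x))"

text \<open>The half-edges \<open>h\<close> with \<open>face_he T h = t\<close> are the three sides of \<open>t\<close>, oriented
  counterclockwise; so the successor of \<open>e\<close> in the winding order is the one that starts where
  \<open>e\<close> ends, and the predecessor is the one that ends where \<open>e\<close> starts.\<close>

definition next_he :: "point set set \<Rightarrow> half_edge \<Rightarrow> half_edge" where
  "next_he T e = (THE h. h \<in> half_edges T \<and> face_he T h = face_he T e \<and> fst h = snd e)"

definition prev_he :: "point set set \<Rightarrow> half_edge \<Rightarrow> half_edge" where
  "prev_he T e = (THE h. h \<in> half_edges T \<and> face_he T h = face_he T e \<and> snd h = fst e)"


section \<open>Oriented distance\<close>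

definition angle_at :: "point \<Rightarrow> point \<Rightarrow> point \<Rightarrow> real" where
  "angle_at q v p = arccos (((q - v) \<bullet> (p - v)) / (norm (q - v) * norm (p - v)))"

text \<open>For \<open>p\<close> off the segment the angle does not depend on \<open>q\<close>; for \<open>p\<close> on the segment the
  value is irrelevant, since the walk never evaluates it there.\<close>

definition od :: "half_edge \<Rightarrow> point \<Rightarrow> real \<times> real" where
  "od e p =
     (let s = closed_segment (fst e) (snd e); c = closest_point s p
      in (dist p c, THE \<alpha>. \<forall>q\<in>s - {c}. angle_at q c p = \<alpha>))"

text \<open>Lexicographic; the library order \<open><\<close> on pairs is the componentwise one here.\<close>

definition od_less :: "real \<times> real \<Rightarrow> real \<times> real \<Rightarrow> bool" where
  "od_less x y \<longleftrightarrow> fst x < fst y \<or> (fst x = fst y \<and> snd x < snd y)"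


section \<open>The oriented distance walk\<close>

definition walk_start :: "point \<Rightarrow> half_edge \<Rightarrow> half_edge" where
  "walk_start p e = (if strictly_right e p then inv_he e else e)"

definition walk_step :: "point set set \<Rightarrow> point \<Rightarrow> half_edge \<Rightarrow> half_edge \<Rightarrow> bool" where
  "walk_step T p e e' \<longleftrightarrow>
     (let l = inv_he (next_he T e); r = inv_he (prev_he T e)
      in if od_less (od l p) (od r p) then e' = l
         else if od_less (od r p) (od l p) then e' = r
         else e' = l \<or> e' = r)"

text \<open>\<open>w n\<close> is the current half-edge after \<open>n\<close> iterations of the loop. Once the loop condition
  \<open>p \<notin> face_he T (w n)\<close> fails, the remaining entries of \<open>w\<close> have no meaning and are
  unconstrained.\<close>

definition walk_run :: "point set set \<Rightarrow> point \<Rightarrow> half_edge \<Rightarrow> (nat \<Rightarrow> half_edge) \<Rightarrow> bool" where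
  "walk_run T p e_init w \<longleftrightarrow>
     w 0 = walk_start p e_init \<and>
     (\<forall>n. (\<forall>k\<le>n. p \<notin> face_he T (w k)) \<longrightarrow> walk_step T p (w n) (w (Suc n)))"

end

theory Submission
  imports Defs
begin

text \<open>The oriented distance of the current half-edge strictly decreases at every step, while \<open>p\<close>
  stays on its left. Let \<open>a b c\<close> be the face to the left of the half-edge \<open>a b\<close>, with \<open>p\<close> to the
  left of \<open>a b\<close> but outside the face. If the point of \<open>a b\<close> closest to \<open>p\<close> is interior to \<open>a b\<close>,
  then the way from it to \<open>p\<close> leaves the face through \<open>b c\<close> or \<open>c a\<close>, at a point closer to \<open>p\<close>.
  If it is an endpoint, the other side of the face at that endpoint is at least as close, and in
  case of equal distance it makes a smaller angle. If \<open>p\<close> lies beyond only one of \<open>b c\<close> and \<open>c a\<close>,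
  the same two arguments show that this one has the smaller oriented distance, so the walk crosses
  it. All half-edges visited thus meet a fixed disc around \<open>p\<close> and are distinct, so by local
  finiteness there are only finitely many of them.\<close>

section \<open>Signed areas, membership in a triangle, and exit through an edge\<close>

lemma point_eq_iff: "x = y \<longleftrightarrow> x $ 1 = y $ 1 \<and> x $ 2 = y $ 2" for x y :: point
  by (simp add: vec_eq_iff forall_2)

lemma side_inv_he: "side (inv_he e) p = - side e p"
  by (simp add: side_def inv_he_def algebra_simps)

lemma side_rotate: "side (b, c) a = side (a, b) c"
  by (simp add: side_def algebra_simps)

lemma side_swap: "side (b, a) p = - side (a, b) p"
  by (simp add: side_def algebra_simps)

lemma side_endpoints [simp]: "side (a, b) a = 0" "side (a, b) b = 0"
  by (simp_all add: side_def)

lemma side_affine: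
  "side e (x + t *\<^sub>R (y - x)) = (1 - t) * side e x + t * side e y"
  by (simp add: side_def algebra_simps)

lemma side_sum: "side (a, b) x + side (b, c) x + side (c, a) x = side (a, b) c"
  by (simp add: side_def algebra_simps)

text \<open>Cramer's rule cleared of its denominator: the barycentric coordinates of
  \<open>x\<close> are the signed areas against the opposite edges, divided by
  \<open>side (a, b) c\<close>.\<close>

lemma side_barycentric:
  "side (a, b) c *\<^sub>R x = side (b, c) x *\<^sub>R a + side (c, a) x *\<^sub>R b + side (a, b) x *\<^sub>R c"
  by (simp add: point_eq_iff side_def algebra_simps)

lemma collinear_iff_side: "collinear {a, b, c} \<longleftrightarrow> side (a, b) c = 0"
proof (cases "a = b")
  case True
  then show ?thesis by (simp add: side_def)
next
  case False
  have "collinear {b, c, a} \<longleftrightarrow> (\<exists>u. c = u *\<^sub>R b + (1 - u) *\<^sub>R a)"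
    using False collinear_3_expand[of b c a] by simp
  also have "\<dots> \<longleftrightarrow> side (a, b) c = 0"
  proof
    assume "\<exists>u. c = u *\<^sub>R b + (1 - u) *\<^sub>R a"
    then obtain u where c: "c = u *\<^sub>R b + (1 - u) *\<^sub>R a" by blast
    show "side (a, b) c = 0"
      unfolding c by (simp add: side_def algebra_simps)
  next
    assume s: "side (a, b) c = 0"
    show "\<exists>u. c = u *\<^sub>R b + (1 - u) *\<^sub>R a"
    proof (cases "b $ 1 = a $ 1")
      case True
      with False have "b $ 2 \<noteq> a $ 2" by (auto simp: point_eq_iff)
      moreover from this have "c $ 1 = a $ 1" using True s by (simp add: side_def)
      moreover define u where "u = (c $ 2 - a $ 2) / (b $ 2 - a $ 2)"
      ultimately have "c $ 2 = a $ 2 + u * (b $ 2 - a $ 2)" by simp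
      then show ?thesis
        using True \<open>c $ 1 = a $ 1\<close>
        by (intro exI[of _ u]) (simp add: point_eq_iff algebra_simps)
    next
      case F: False
      define u where "u = (c $ 1 - a $ 1) / (b $ 1 - a $ 1)"
      have "c $ 1 = a $ 1 + u * (b $ 1 - a $ 1)" using F by (simp add: u_def)
      moreover have "c $ 2 = a $ 2 + u * (b $ 2 - a $ 2)"
        using F s by (simp add: u_def side_def field_simps)
      ultimately show ?thesis
        by (intro exI[of _ u]) (simp add: point_eq_iff algebra_simps)
    qed
  qed
  finally show ?thesis by (simp add: insert_commute)
qed

lemma mem_triangle_iff:
  assumes D: "side (a, b) c > 0"
  shows "x \<in> convex hull {a, b, c} \<longleftrightarrow>
    side (a, b) x \<ge> 0 \<and> side (b, c) x \<ge> 0 \<and> side (c, a) x \<ge> 0"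
proof
  assume "x \<in> convex hull {a, b, c}"
  then obtain u v w where uvw: "0 \<le> u" "0 \<le> v" "0 \<le> w" "u + v + w = 1"
    and x: "x = u *\<^sub>R a + v *\<^sub>R b + w *\<^sub>R c"
    by (auto simp: convex_hull_3)
  have u: "u = 1 - v - w" using uvw by simp
  have "side (a, b) x = w * side (a, b) c" "side (b, c) x = u * side (a, b) c"
    "side (c, a) x = v * side (a, b) c"
    unfolding x u by (simp_all add: side_def algebra_simps)
  with D uvw show "side (a, b) x \<ge> 0 \<and> side (b, c) x \<ge> 0 \<and> side (c, a) x \<ge> 0"
    by simp
next
  let ?D = "side (a, b) c"
  assume s: "side (a, b) x \<ge> 0 \<and> side (b, c) x \<ge> 0 \<and> side (c, a) x \<ge> 0"
  have "x = (1 / ?D) *\<^sub>R (?D *\<^sub>R x)"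
    using D by simp
  also have "\<dots> = (side (b, c) x / ?D) *\<^sub>R a + (side (c, a) x / ?D) *\<^sub>R b + (side (a, b) x / ?D) *\<^sub>R c"
    unfolding side_barycentric[of a b c x] by (simp add: scaleR_add_right)
  finally have "x = (side (b, c) x / ?D) *\<^sub>R a + (side (c, a) x / ?D) *\<^sub>R b + (side (a, b) x / ?D) *\<^sub>R c" .
  moreover have "side (b, c) x / ?D + side (c, a) x / ?D + side (a, b) x / ?D = 1"
    using D side_sum[of a b x c] by (simp add: field_simps)
  ultimately show "x \<in> convex hull {a, b, c}"
    using s D unfolding convex_hull_3 mem_Collect_eq
    by (metis divide_nonneg_pos)
qed

text \<open>The barycentric coordinate belonging to \<open>a\<close> vanishes, which leaves a convex
  combination of \<open>b\<close> and \<open>c\<close>.\<close>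

lemma mem_edge:
  assumes D: "side (a, b) c > 0"
    and "side (b, c) x = 0" "side (a, b) x \<ge> 0" "side (c, a) x \<ge> 0"
  shows "x \<in> closed_segment b c"
proof -
  let ?D = "side (a, b) c"
  have "x = (1 / ?D) *\<^sub>R (?D *\<^sub>R x)"
    using D by simp
  also have "\<dots> = (side (c, a) x / ?D) *\<^sub>R b + (side (a, b) x / ?D) *\<^sub>R c"
    unfolding side_barycentric[of a b c x] using assms(2) by (simp add: scaleR_add_right)
  also have "side (c, a) x / ?D = 1 - side (a, b) x / ?D"
    using D side_sum[of a b x c] assms(2) by (simp add: field_simps)
  finally show ?thesis
    using side_sum[of a b x c] assms unfolding in_segment
    by (intro exI[of _ "side (a, b) x / ?D"]) auto
qed

text \<open>Each \<open>side\<close> is affine on the way from \<open>x\<close> to \<open>p\<close>.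
  The two that are nonnegative at both ends stay so, and the zero of the third is the exit
  point.\<close>

lemma exit_through_edge:
  assumes D: "side (a, b) c > 0"
    and x: "side (b, c) x > 0" "side (a, b) x \<ge> 0" "side (c, a) x \<ge> 0"
    and p: "side (b, c) p < 0" "side (a, b) p \<ge> 0" "side (c, a) p \<ge> 0"
  shows "\<exists>t. 0 < t \<and> t < 1 \<and> x + t *\<^sub>R (p - x) \<in> closed_segment b c"
proof -
  define t where "t = side (b, c) x / (side (b, c) x - side (b, c) p)"
  have t: "0 < t" "t < 1"
    using x p by (auto simp: t_def field_simps)
  have "side (b, c) x - side (b, c) p \<noteq> 0" using x p by linarith
  then have "side (b, c) (x + t *\<^sub>R (p - x)) = 0"
    unfolding side_affine by (simp add: t_def field_simps)
  moreover have "side (a, b) (x + t *\<^sub>R (p - x)) \<ge> 0" "side (c, a) (x + t *\<^sub>R (p - x)) \<ge> 0"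
    unfolding side_affine using x p t by auto
  ultimately show ?thesis using mem_edge[OF D] t by blast
qed

lemma dist_towards_less:
  fixes x p :: "'a::real_normed_vector"
  assumes "0 < t" "t < 1" "x \<noteq> p"
  shows "dist p (x + t *\<^sub>R (p - x)) < dist p x"
proof -
  have "p - (x + t *\<^sub>R (p - x)) = (1 - t) *\<^sub>R (p - x)"
    by (simp add: algebra_simps)
  then have "dist p (x + t *\<^sub>R (p - x)) = (1 - t) * dist p x"
    using assms by (simp add: dist_norm)
  with assms show ?thesis by simp
qed

lemma exit_triangle_upwards:
  assumes D: "side (a, b) c > 0"
    and x: "side (a, b) x \<ge> 0" "side (b, c) x > 0" "side (c, a) x > 0"
    and p: "side (a, b) p \<ge> 0" "p \<notin> convex hull {a, b, c}"
  shows "\<exists>t. 0 < t \<and> t < 1 \<and> x + t *\<^sub>R (p - x) \<in> closed_segment b c \<union> closed_segment c a"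
proof -
  have D': "side (b, c) a > 0" using D by (simp add: side_rotate)
  consider "side (b, c) p < 0" "side (c, a) p \<ge> 0" | "side (c, a) p < 0" "side (b, c) p \<ge> 0"
    | "side (b, c) p < 0" "side (c, a) p < 0"
    using p mem_triangle_iff[OF D, of p] by linarith
  then show ?thesis
  proof cases
    case 1
    then show ?thesis
      using exit_through_edge[OF D, of x p] x p(1) by (meson UnI1 less_imp_le)
  next
    case 2
    then show ?thesis
      using exit_through_edge[OF D', of x p] x p(1) by (meson UnI2 less_imp_le)
  next
    case 3
    \<comment> \<open>Here both lines are crossed. \<open>z\<close> is the crossing with the line
      \<open>b c\<close>; if it already lies beyond \<open>c a\<close>, then the way from
      \<open>x\<close> to \<open>z\<close> leaves through \<open>c a\<close>, and the two parameters
      multiply.\<close>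
    define t where "t = side (b, c) x / (side (b, c) x - side (b, c) p)"
    define z where "z = x + t *\<^sub>R (p - x)"
    have t: "0 < t" "t < 1"
      using x 3 by (auto simp: t_def field_simps)
    have "side (b, c) x - side (b, c) p \<noteq> 0" using x 3 by linarith
    then have z: "side (b, c) z = 0"
      unfolding z_def side_affine by (simp add: t_def field_simps)
    have z': "side (a, b) z \<ge> 0"
      unfolding z_def side_affine using x p t by auto
    show ?thesis
    proof (cases "side (c, a) z \<ge> 0")
      case True
      then show ?thesis using mem_edge[OF D z z'] t z_def by blast
    next
      case False
      then obtain s where s: "0 < s" "s < 1" "x + s *\<^sub>R (z - x) \<in> closed_segment c a"
        using exit_through_edge[OF D', of x z] x z z' by auto
      have "x + s *\<^sub>R (z - x) = x + (s * t) *\<^sub>R (p - x)"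
        by (simp add: z_def)
      moreover have "s * t < 1"
        using s t mult_strict_mono[of s 1 t 1] by simp
      ultimately show ?thesis using s t by (intro exI[of _ "s * t"]) auto
    qed
  qed
qed

section \<open>Oriented distance of segments with a common end point\<close>

lemma od_commute: "od (a, b) p = od (b, a) p"
  by (simp add: od_def closed_segment_commute)

lemma fst_od: "fst (od (a, b) p) = dist p (closest_point (closed_segment a b) p)"
  by (simp add: od_def Let_def)

lemma fst_od_le: "z \<in> closed_segment a b \<Longrightarrow> fst (od (a, b) p) \<le> dist p z"
  by (simp add: fst_od closest_point_le)

lemma od_less_trans: "od_less x y \<Longrightarrow> od_less y z \<Longrightarrow> od_less x z"
  by (auto simp: od_less_def)

text \<open>All points of the segment other than \<open>v\<close> lie on one ray from
  \<open>v\<close>, so the description in \<open>od\<close> has exactly one solution.\<close>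

lemma snd_od_at_endpoint:
  assumes v: "closest_point (closed_segment v x) p = v" and "x \<noteq> v"
  shows "snd (od (v, x) p) = angle_at x v p"
proof -
  have same: "angle_at q v p = angle_at x v p" if "q \<in> closed_segment v x - {v}" for q
  proof -
    from that obtain u where u: "0 \<le> u" "q = (1 - u) *\<^sub>R v + u *\<^sub>R x"
      by (auto simp: in_segment)
    with that have "0 < u" by (auto simp: less_le)
    moreover have "q - v = u *\<^sub>R (x - v)" using u by (simp add: algebra_simps)
    ultimately show ?thesis by (simp add: angle_at_def)
  qed
  have x: "x \<in> closed_segment v x - {v}" using assms by simp
  have "(THE \<alpha>. \<forall>q\<in>closed_segment v x - {v}. angle_at q v p = \<alpha>) = angle_at x v p"
  proof (rule the_equality)
    show "\<forall>q\<in>closed_segment v x - {v}. angle_at q v p = angle_at x v p"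
      using same by (rule ballI)
  next
    fix \<alpha> assume "\<forall>q\<in>closed_segment v x - {v}. angle_at q v p = \<alpha>"
    from bspec[OF this x] show "\<alpha> = angle_at x v p" by (rule sym)
  qed
  then show ?thesis by (simp add: od_def Let_def v)
qed

text \<open>Variational inequality of the projection onto a convex set: the angle at
  \<open>v\<close> is at least a right one.\<close>

lemma closest_endpoint_inner_le:
  assumes "closest_point (closed_segment v x) p = v"
  shows "(x - v) \<bullet> (p - v) \<le> 0"
  using closest_point_dot[of "closed_segment v x" x p] assms
  by (simp add: inner_commute)

lemma angle_at_bound: "\<bar>((q - v) \<bullet> (p - v)) / (norm (q - v) * norm (p - v))\<bar> \<le> 1"
  using Cauchy_Schwarz_ineq2[of "q - v" "p - v"]
  by (cases "norm (q - v) * norm (p - v) = 0") (auto simp: abs_mult divide_le_eq_1 abs_divide)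

text \<open>Taking \<open>x\<close> as first axis, turning it towards \<open>u\<close> into \<open>y\<close> increases the inner product
  with \<open>u\<close>.\<close>

lemma inner_less_of_turn:
  fixes x y u :: point
  defines "cr \<equiv> \<lambda>a b :: point. a $ 1 * b $ 2 - a $ 2 * b $ 1"
  assumes nx: "norm x = 1" and ny: "norm y = 1" and "u \<noteq> 0" and xu: "x \<bullet> u \<le> 0"
    and xy: "cr x y \<noteq> 0" and turn: "cr x y * cr x u \<ge> 0"
  shows "x \<bullet> u < y \<bullet> u"
proof -
  note inner = inner_vec_def sum_2
  have x1: "(x $ 1)\<^sup>2 + (x $ 2)\<^sup>2 = 1" and y1: "(y $ 1)\<^sup>2 + (y $ 2)\<^sup>2 = 1"
    using nx ny by (simp_all add: norm_eq_1 inner power2_eq_square)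
  \<comment> \<open>\<open>cr x v\<close> is the inner product of \<open>v\<close> with
    \<open>x\<close> turned counterclockwise by a right angle, so this is Parseval's identity in an
    orthonormal basis.\<close>
  have expand: "y \<bullet> v = (x \<bullet> y) * (x \<bullet> v) + cr x y * cr x v" for v
  proof -
    have "(x \<bullet> y) * (x \<bullet> v) + cr x y * cr x v = ((x $ 1)\<^sup>2 + (x $ 2)\<^sup>2) * (y \<bullet> v)"
      by (simp add: inner cr_def power2_eq_square algebra_simps)
    then show ?thesis using x1 by simp
  qed
  have "(x \<bullet> y)\<^sup>2 + (cr x y)\<^sup>2 = 1"
    using expand[of y] ny by (simp add: norm_eq_1 power2_eq_square)
  moreover have "(cr x y)\<^sup>2 > 0" using xy by simp
  ultimately have "(x \<bullet> y)\<^sup>2 < 1" by linarith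
  then have "(x \<bullet> y)\<^sup>2 < 1\<^sup>2" by simp
  then have xy1: "x \<bullet> y < 1" using power_less_imp_less_base zero_le_one by blast
  \<comment> \<open>Neither summand is negative. The first vanishes only for
    \<open>x \<bullet> u = 0\<close>; then \<open>u\<close> is a nonzero vector orthogonal to
    \<open>x\<close>, and the second summand is positive.\<close>
  have diff: "y \<bullet> u - x \<bullet> u = (x \<bullet> u) * (x \<bullet> y - 1) + cr x y * cr x u"
    by (subst (1) expand) (simp add: algebra_simps)
  show ?thesis
  proof (cases "x \<bullet> u = 0")
    case True
    have "cr x u \<noteq> 0"
    proof
      assume "cr x u = 0"
      have "u $ 1 = ((x $ 1)\<^sup>2 + (x $ 2)\<^sup>2) * u $ 1" "u $ 2 = ((x $ 1)\<^sup>2 + (x $ 2)\<^sup>2) * u $ 2"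
        using x1 by auto
      then have "u $ 1 = x $ 1 * (x \<bullet> u) - x $ 2 * cr x u" "u $ 2 = x $ 2 * (x \<bullet> u) + x $ 1 * cr x u"
        by (simp_all add: inner cr_def power2_eq_square algebra_simps)
      with True \<open>cr x u = 0\<close> \<open>u \<noteq> 0\<close> show False by (simp add: point_eq_iff)
    qed
    with turn xy have "cr x y * cr x u > 0" by (simp add: less_le)
    with diff True show ?thesis by simp
  next
    case False
    with xu xy1 have "(x \<bullet> u) * (x \<bullet> y - 1) > 0" by (intro mult_neg_neg) auto
    with diff turn show ?thesis by linarith
  qed
qed

text \<open>Either \<open>v y\<close> contains a point closer than \<open>v\<close>, or the
  distances tie and the angle decides: it is at least right towards \<open>x\<close>, and turning to
  \<open>y\<close>, on the side of \<open>p\<close>, makes it smaller. The sign condition is a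
  product so that it covers turns in both directions.\<close>

lemma od_less_pivot:
  assumes v: "closest_point (closed_segment v x) p = v"
    and "p \<noteq> v" and turn: "side (v, x) y * side (v, x) p \<ge> 0" and nz: "side (v, x) y \<noteq> 0"
  shows "od_less (od (v, y) p) (od (v, x) p)"
proof (cases "fst (od (v, y) p) < fst (od (v, x) p)")
  case True
  then show ?thesis by (simp add: od_less_def)
next
  case False
  have xv: "x \<noteq> v" and yv: "y \<noteq> v"
    using nz by (auto simp: side_def)
  have "fst (od (v, y) p) \<le> dist p v" "fst (od (v, x) p) = dist p v"
    by (simp add: fst_od_le) (simp add: fst_od v)
  with False have eq: "fst (od (v, y) p) = dist p v" "fst (od (v, x) p) = dist p v"
    by auto
  \<comment> \<open>In the tie \<open>v\<close> attains the minimum on \<open>v y\<close> too, and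
    the projection is unique.\<close>
  have "v = closest_point (closed_segment v y) p"
    using fst_od_le[of _ v y p] eq(1) by (intro closest_point_unique) auto
  then have vy: "closest_point (closed_segment v y) p = v" by simp
  let ?u = "p - v"
  define x' where "x' = (1 / norm (x - v)) *\<^sub>R (x - v)"
  define y' where "y' = (1 / norm (y - v)) *\<^sub>R (y - v)"
  have n: "norm x' = 1" "norm y' = 1" using xv yv by (auto simp: x'_def y'_def)
  have xu: "x' \<bullet> ?u \<le> 0"
    using closest_endpoint_inner_le[OF v] by (simp add: x'_def divide_nonpos_nonneg)
  have cxy: "x' $ 1 * y' $ 2 - x' $ 2 * y' $ 1 = side (v, x) y / (norm (x - v) * norm (y - v))"
    and cxu: "x' $ 1 * ?u $ 2 - x' $ 2 * ?u $ 1 = side (v, x) p / norm (x - v)"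
    using xv yv by (simp_all add: x'_def y'_def side_def divide_simps)
  have "x' \<bullet> ?u < y' \<bullet> ?u"
  proof (rule inner_less_of_turn[OF n _ xu])
    show "?u \<noteq> 0" using \<open>p \<noteq> v\<close> by simp
    show "x' $ 1 * y' $ 2 - x' $ 2 * y' $ 1 \<noteq> 0" using nz xv yv by (simp add: cxy)
    show "0 \<le> (x' $ 1 * y' $ 2 - x' $ 2 * y' $ 1) * (x' $ 1 * ?u $ 2 - x' $ 2 * ?u $ 1)"
      unfolding cxy cxu using turn by (simp add: zero_le_divide_iff)
  qed
  then have "(x' \<bullet> ?u) / norm ?u < (y' \<bullet> ?u) / norm ?u"
    using \<open>p \<noteq> v\<close> by (simp add: divide_strict_right_mono)
  then have "((x - v) \<bullet> ?u) / (norm (x - v) * norm ?u) < ((y - v) \<bullet> ?u) / (norm (y - v) * norm ?u)"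
    by (simp add: x'_def y'_def)
  \<comment> \<open>\<open>arccos\<close> is decreasing on \<open>[-1, 1]\<close>, so the larger
    cosine has the smaller angle.\<close>
  then have "angle_at y v p < angle_at x v p"
    unfolding angle_at_def
    using angle_at_bound[of x v p] angle_at_bound[of y v p]
    by (subst arccos_less_mono) auto
  then show ?thesis
    using eq by (simp add: od_less_def snd_od_at_endpoint[OF v xv] snd_od_at_endpoint[OF vy yv])
qed

section \<open>Comparison of the oriented distances of the sides of one triangle\<close>

lemma od_less_if_closer:
  assumes "z \<in> closed_segment c d" "dist p z < dist p (closest_point (closed_segment a b) p)"
  shows "od_less (od (c, d) p) (od (a, b) p)"
  using fst_od_le[OF assms(1), of p] assms(2) by (simp add: od_less_def fst_od)

lemma closest_point_mem_segment: "closest_point (closed_segment a b) p \<in> closed_segment a b"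
  by (simp add: closest_point_in_set)

lemma segment_point_eq:
  assumes "x \<in> closed_segment a b"
  obtains t where "0 \<le> t" "t \<le> 1" "x = a + t *\<^sub>R (b - a)"
  using assms by (auto simp: in_segment algebra_simps)

lemma triangle_edges_subset:
  "closed_segment a b \<subseteq> convex hull {a, b, c}"
  "closed_segment b c \<subseteq> convex hull {a, b, c}"
  "closed_segment c a \<subseteq> convex hull {a, b, c}"
  by (auto simp: segment_convex_hull intro: hull_mono[THEN subsetD, rotated])

text \<open>The disjunction suffices for the walk: it moves to the smaller of the two values, and in
  a tie either choice has the same value.\<close>

lemma od_decreases:
  assumes D: "side (a, b) c > 0" and p: "side (a, b) p \<ge> 0" "p \<notin> convex hull {a, b, c}"
  shows "od_less (od (c, b) p) (od (a, b) p) \<or> od_less (od (a, c) p) (od (a, b) p)"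
proof -
  define m where "m = closest_point (closed_segment a b) p"
  have m: "m \<in> closed_segment a b" unfolding m_def by (rule closest_point_mem_segment)
  have pne: "p \<noteq> a" "p \<noteq> b" "p \<noteq> m"
    using p(2) m triangle_edges_subset(1)[of a b c] by (auto simp: hull_inc)
  consider "m = a" | "m = b" | "m \<noteq> a" "m \<noteq> b" by blast
  then show ?thesis
  proof cases
    case 1
    then have "od_less (od (a, c) p) (od (a, b) p)"
      using D p pne by (intro od_less_pivot) (auto simp: m_def)
    then show ?thesis ..
  next
    case 2
    \<comment> \<open>Seen from \<open>b\<close> the turn is clockwise: both factors of the sign
      condition change sign.\<close>
    then have "od_less (od (b, c) p) (od (b, a) p)"
      using D p pne
      by (intro od_less_pivot) (auto simp: m_def closed_segment_commute side_swap[of b a])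
    then show ?thesis by (simp add: od_commute)
  next
    case 3
    obtain u where u: "0 \<le> u" "u \<le> 1" "m = a + u *\<^sub>R (b - a)"
      using m by (rule segment_point_eq)
    with 3 have "0 < u" "u < 1" by (auto simp: less_le)
    moreover have "side (b, c) m = (1 - u) * side (a, b) c" "side (c, a) m = u * side (a, b) c"
      "side (a, b) m = 0"
      unfolding u(3) side_affine by (auto simp: side_rotate[of b c a] side_rotate[of c a b])
    ultimately have "side (a, b) m \<ge> 0" "side (b, c) m > 0" "side (c, a) m > 0"
      using D by auto
    then obtain t where t: "0 < t" "t < 1"
      and z: "m + t *\<^sub>R (p - m) \<in> closed_segment b c \<union> closed_segment c a"
      using exit_triangle_upwards[OF D _ _ _ p] by blast
    have "dist p (m + t *\<^sub>R (p - m)) < dist p m"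
      using t pne by (intro dist_towards_less) auto
    with z have "od_less (od (b, c) p) (od (a, b) p) \<or> od_less (od (c, a) p) (od (a, b) p)"
      unfolding m_def using od_less_if_closer by blast
    then show ?thesis by (simp add: od_commute)
  qed
qed

text \<open>If the point of \<open>c a\<close> closest to \<open>p\<close> is \<open>c\<close>,
  pivot about \<open>c\<close>; otherwise it lies strictly inside \<open>b c\<close>, and the way to
  \<open>p\<close> crosses \<open>b c\<close> at a closer point. For \<open>p\<close> on the line
  \<open>c a\<close> no comparison is made, since crossing either edge then keeps \<open>p\<close>
  weakly to the left.\<close>

lemma od_less_crossed:
  assumes D: "side (a, b) c > 0"
    and p: "side (b, c) p < 0" "side (a, b) p \<ge> 0" "side (c, a) p > 0"
  shows "od_less (od (b, c) p) (od (c, a) p)"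
proof -
  define x where "x = closest_point (closed_segment c a) p"
  have x: "x \<in> closed_segment c a" unfolding x_def by (rule closest_point_mem_segment)
  have pc: "p \<noteq> c" "p \<noteq> x"
    using p x by (auto elim!: segment_point_eq simp: side_affine)
  show ?thesis
  proof (cases "x = c")
    case True
    have "od_less (od (c, b) p) (od (c, a) p)"
      using True D p pc by (intro od_less_pivot) (auto simp: x_def side_rotate[of c a b] side_rotate[of b c a])
    then show ?thesis by (simp add: od_commute)
  next
    case False
    obtain u where u: "0 \<le> u" "u \<le> 1" "x = c + u *\<^sub>R (a - c)"
      using x by (rule segment_point_eq)
    with False have "0 < u" by (auto simp: less_le)
    moreover have "side (b, c) x = u * side (a, b) c" "side (a, b) x = (1 - u) * side (a, b) c"
      "side (c, a) x = 0"
      unfolding u(3) side_affine by (auto simp: side_rotate[of b c a])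
    ultimately have "side (b, c) x > 0" "side (a, b) x \<ge> 0" "side (c, a) x \<ge> 0"
      using D u by auto
    then obtain t where t: "0 < t" "t < 1" "x + t *\<^sub>R (p - x) \<in> closed_segment b c"
      using exit_through_edge[OF D _ _ _ p(1,2)] p(3) by (meson less_imp_le)
    have "dist p (x + t *\<^sub>R (p - x)) < dist p x"
      using t pc by (intro dist_towards_less) auto
    with t show ?thesis unfolding x_def by (intro od_less_if_closer)
  qed
qed

text \<open>Mirror image of \<open>od_less_crossed\<close>. A reflection reverses the sign of
  \<open>side\<close>, so rotating the vertex names does not turn one into the other.\<close>

lemma od_less_crossed':
  assumes D: "side (a, b) c > 0"
    and p: "side (b, c) p > 0" "side (a, b) p \<ge> 0" "side (c, a) p < 0"
  shows "od_less (od (c, a) p) (od (b, c) p)"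
proof -
  define x where "x = closest_point (closed_segment b c) p"
  have x: "x \<in> closed_segment b c" unfolding x_def by (rule closest_point_mem_segment)
  have D': "side (b, c) a > 0" using D by (simp add: side_rotate)
  have pc: "p \<noteq> c" "p \<noteq> x"
    using p x by (auto elim!: segment_point_eq simp: side_affine)
  show ?thesis
  proof (cases "x = c")
    case True
    have "od_less (od (c, a) p) (od (c, b) p)"
      using True D' p pc
      by (intro od_less_pivot) (auto simp: x_def closed_segment_commute side_swap[of c b])
    then show ?thesis by (simp add: od_commute)
  next
    case False
    obtain u where u: "0 \<le> u" "u \<le> 1" "x = b + u *\<^sub>R (c - b)"
      using x by (rule segment_point_eq)
    with False have "u < 1" by (auto simp: less_le)
    moreover have "side (c, a) x = (1 - u) * side (a, b) c" "side (a, b) x = u * side (a, b) c"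
      "side (b, c) x = 0"
      unfolding u(3) side_affine by (auto simp: side_rotate[of c a b] side_rotate[of a b c])
    ultimately have "side (c, a) x > 0" "side (a, b) x \<ge> 0" "side (b, c) x \<ge> 0"
      using D u by auto
    then obtain t where t: "0 < t" "t < 1" "x + t *\<^sub>R (p - x) \<in> closed_segment c a"
      using exit_through_edge[OF D' _ _ _ p(3) _ p(2)] p(1) by (meson less_imp_le)
    have "dist p (x + t *\<^sub>R (p - x)) < dist p x"
      using t pc by (intro dist_towards_less) auto
    with t show ?thesis unfolding x_def by (intro od_less_if_closer)
  qed
qed

section \<open>Edges of a triangle\<close>

lemma edge_of_triangle_iff:
  fixes a b c :: point
  assumes nc: "\<not> collinear {a, b, c}"
  shows "s edge_of convex hull {a, b, c} \<longleftrightarrow>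
    s \<in> {closed_segment a b, closed_segment b c, closed_segment c a}"
proof -
  have ind: "\<not> affine_dependent {a, b, c}" and ne: "a \<noteq> b" "a \<noteq> c" "b \<noteq> c"
    using nc by (auto simp: collinear_3_eq_affine_dependent)
  have seg: "aff_dim (closed_segment x y) = 1" if "x \<noteq> y" for x y :: point
    using that by (simp add: segment_convex_hull aff_dim_convex_hull aff_dim_2)
  have "s \<in> {closed_segment a b, closed_segment b c, closed_segment c a}"
    if "s edge_of convex hull {a, b, c}"
  proof -
    \<comment> \<open>Faces of a simplex are the hulls of subsets of its vertices; dimension one
      leaves the two-element subsets.\<close>
    from that obtain S where S: "S \<subseteq> {a, b, c}" "s = convex hull S" "aff_dim s = 1"
      using face_of_convex_hull_affine_independent[OF ind] by (auto simp: edge_of_def)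
    have "\<not> affine_dependent S" using ind S(1) affine_independent_subset by blast
    then have "card S = 2"
      using S aff_dim_affine_independent[of S] by (simp add: aff_dim_convex_hull)
    then obtain x y where "S = {x, y}" "x \<noteq> y" by (auto simp: card_2_iff)
    then have "s = closed_segment x y" using S by (simp add: segment_convex_hull)
    with \<open>S = {x, y}\<close> S(1) \<open>x \<noteq> y\<close> show ?thesis by auto
  qed
  moreover have "closed_segment x y edge_of convex hull {a, b, c}"
    if "x \<noteq> y" "{x, y} \<subseteq> {a, b, c}" for x y
    unfolding edge_of_def face_of_convex_hull_affine_independent[OF ind]
    using seg[OF that(1)] that(2) segment_convex_hull by blast
  then have "s edge_of convex hull {a, b, c}"
    if "s \<in> {closed_segment a b, closed_segment b c, closed_segment c a}"
    using that ne by auto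
  ultimately show ?thesis by blast
qed

lemma triangle_with_edge:
  assumes "closed_triangle t" "closed_segment x y edge_of t"
  obtains z where "side (x, y) z \<noteq> 0" "t = convex hull {x, y, z}"
proof -
  obtain a b c where nc: "\<not> collinear {a, b, c}" and t: "t = convex hull {a, b, c}"
    using assms(1) by (auto simp: closed_triangle_def)
  have "closed_segment x y \<in> {closed_segment a b, closed_segment b c, closed_segment c a}"
    using assms(2) edge_of_triangle_iff[OF nc] t by simp
  then have "\<exists>z. {x, y, z} = {a, b, c}"
    by (auto simp: doubleton_eq_iff)
  then obtain z where "{x, y, z} = {a, b, c}" by blast
  then show thesis using that nc t collinear_iff_side by metis
qed

lemma segment_edge_of_triangle:
  assumes "side (a, b) c \<noteq> 0"
  shows "closed_segment a b edge_of convex hull {a, b, c}"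
  using assms edge_of_triangle_iff collinear_iff_side by blast

text \<open>The segment is a face of \<open>f\<close>, and a proper face would have smaller
  dimension.\<close>

lemma segment_edge_unique:
  assumes "closed_segment a b edge_of s" "f edge_of s" "closed_segment a b \<subseteq> f"
  shows "f = closed_segment a b"
proof -
  have "closed_segment a b face_of f"
    using assms face_of_subset edge_of_imp_subset unfolding edge_of_def by metis
  moreover have "convex f" using assms face_of_imp_convex by (auto simp: edge_of_def)
  ultimately show ?thesis
    using face_of_aff_dim_lt assms by (fastforce simp: edge_of_def)
qed

section \<open>Uniqueness and existence of the face to the left of a half-edge\<close>

lemma left_face_triangle:
  assumes "closed_triangle t" "closed_segment a b edge_of t" "\<forall>x\<in>t. \<not> strictly_right (a, b) x"
  obtains c where "side (a, b) c > 0" "t = convex hull {a, b, c}"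
proof -
  obtain z where "side (a, b) z \<noteq> 0" "t = convex hull {a, b, z}"
    using triangle_with_edge assms by blast
  moreover then have "side (a, b) z \<ge> 0"
    using assms(3) by (auto simp: strictly_right_def not_less hull_inc)
  ultimately show thesis using that by force
qed

lemma triangle_side_nonneg:
  assumes "side (a, b) c > 0" "x \<in> convex hull {a, b, c}"
  shows "\<not> strictly_right (a, b) x"
  using assms mem_triangle_iff by (auto simp: strictly_right_def not_less)

lemma midpoint_sides:
  "side (a, b) (midpoint a b) = 0"
  "side (b, c) (midpoint a b) = side (a, b) c / 2"
  "side (c, a) (midpoint a b) = side (a, b) c / 2"
  by (simp_all add: side_def midpoint_def field_simps)

text \<open>If the triangles differed, edge-to-edge contact would make \<open>a b\<close> their
  whole intersection, yet they share a point strictly to its left.\<close>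

lemma left_triangle_unique:
  assumes T: "plane_triangulation T"
    and s: "convex hull {a, b, c} \<in> T" "side (a, b) c > 0"
    and t: "convex hull {a, b, d} \<in> T" "side (a, b) d > 0"
  shows "convex hull {a, b, c} = convex hull {a, b, d}"
proof (rule ccontr)
  let ?s = "convex hull {a, b, c}" and ?t = "convex hull {a, b, d}" and ?m = "midpoint a b"
  assume ne: "?s \<noteq> ?t"
  have ab: "a \<noteq> b" using s by (auto simp: side_def)
  have abs: "closed_segment a b \<subseteq> ?s \<inter> ?t"
    using triangle_edges_subset by blast
  have "?s \<inter> ?t \<noteq> {}" "\<nexists>v. ?s \<inter> ?t = {v}"
    using abs ab by (auto simp: set_eq_iff subset_iff) (metis ends_in_segment)+
  then have "(?s \<inter> ?t) edge_of ?s"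
    using T s t ne unfolding plane_triangulation_def edge_to_edge_def by metis
  then have st: "?s \<inter> ?t = closed_segment a b"
    using segment_edge_unique segment_edge_of_triangle abs s by (metis less_irrefl)
  have "\<exists>z \<in> ?s \<inter> ?t. side (a, b) z > 0"
  proof (cases "c \<in> ?t")
    case True
    then show ?thesis using s by (intro bexI[of _ c]) (auto simp: hull_inc)
  next
    case False
    \<comment> \<open>The way from the midpoint to \<open>c\<close> stays in the first triangle and
      leaves the second through one of its other two sides; that exit point is shared.\<close>
    obtain u where u: "0 < u" "u < 1"
      and z: "?m + u *\<^sub>R (c - ?m) \<in> closed_segment b d \<union> closed_segment d a"
      using exit_triangle_upwards[OF t(2), of ?m c] s t False midpoint_sides[of a b]
      by (auto simp: midpoint_sides)
    then have "?m + u *\<^sub>R (c - ?m) \<in> ?t"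
      using triangle_edges_subset by blast
    moreover have "?m + u *\<^sub>R (c - ?m) \<in> ?s"
    proof -
      have "?m \<in> ?s" using abs midpoint_in_closed_segment by blast
      moreover have "c \<in> ?s" by (simp add: hull_inc)
      ultimately have "(1 - u) *\<^sub>R ?m + u *\<^sub>R c \<in> ?s"
        using u convexD_alt[OF convex_convex_hull] by (metis less_imp_le)
      then show ?thesis by (simp add: algebra_simps)
    qed
    moreover have "side (a, b) (?m + u *\<^sub>R (c - ?m)) > 0"
      using u s by (simp add: side_affine midpoint_sides)
    ultimately show ?thesis by blast
  qed
  then show False
    unfolding st by (auto elim!: segment_point_eq simp: side_affine)
qed

lemma face_he_eq:
  assumes T: "plane_triangulation T" and s: "convex hull {a, b, c} \<in> T" "side (a, b) c > 0"
  shows "face_he T (a, b) = convex hull {a, b, c}"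
  unfolding face_he_def fst_conv snd_conv
proof (rule the_equality)
  show "convex hull {a, b, c} \<in> T \<and> closed_segment a b edge_of convex hull {a, b, c} \<and>
    (\<forall>x\<in>convex hull {a, b, c}. \<not> strictly_right (a, b) x)"
    using s segment_edge_of_triangle triangle_side_nonneg by (metis less_irrefl)
next
  fix t
  assume t: "t \<in> T \<and> closed_segment a b edge_of t \<and> (\<forall>x\<in>t. \<not> strictly_right (a, b) x)"
  then obtain d where "side (a, b) d > 0" "t = convex hull {a, b, d}"
    using T left_face_triangle unfolding plane_triangulation_def by metis
  with t show "t = convex hull {a, b, c}"
    using left_triangle_unique[OF T] s by metis
qed

text \<open>Only finitely many faces near the midpoint miss it, and they are closed, so some disc
  around it avoids them all. A point of that disc shifted towards \<open>y\<close> lies in some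
  face, which must contain the midpoint.\<close>

lemma triangle_across_midpoint:
  assumes T: "plane_triangulation T" and lf: "locally_finite T" and y: "side (a, b) y > 0"
  obtains t q where "t \<in> T" "midpoint a b \<in> t" "q \<in> t" "side (a, b) q > 0"
proof -
  let ?m = "midpoint a b"
  define F where "F = {t \<in> T. t \<inter> cball ?m 1 \<noteq> {} \<and> ?m \<notin> t}"
  have "finite {t \<in> T. t \<inter> cball ?m 1 \<noteq> {}}"
    using lf by (auto simp: locally_finite_def)
  then have "finite F" by (rule rev_finite_subset) (auto simp: F_def)
  moreover have "closed t" if "t \<in> F" for t
    using T that
    by (auto simp: F_def plane_triangulation_def closed_triangle_def compact_imp_closed
        finite_imp_compact_convex_hull)
  ultimately have "open (- \<Union>F)" by (simp add: closed_Union open_Compl)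
  moreover have "?m \<in> - \<Union>F" by (auto simp: F_def)
  ultimately obtain e where e: "e > 0" "ball ?m e \<subseteq> - \<Union>F"
    using open_contains_ball by blast
  \<comment> \<open>Scaled so that \<open>q\<close> stays both in the disc of radius
    \<open>e\<close> and in the unit disc that defines \<open>F\<close>; the added one keeps the
    denominator positive.\<close>
  define d where "d = min e 1 / 2 / (norm (y - ?m) + 1)"
  define q where "q = ?m + d *\<^sub>R (y - ?m)"
  have N: "norm (y - ?m) + 1 > 0" by (simp add: add_nonneg_pos)
  have d: "d > 0" using e N by (simp add: d_def)
  have "dist ?m q = min e 1 / 2 * (norm (y - ?m) / (norm (y - ?m) + 1))"
    using d by (simp add: q_def dist_norm) (simp add: d_def)
  also have "\<dots> \<le> min e 1 / 2 * 1"
    using N e by (intro mult_left_mono) auto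
  also have "\<dots> < min e 1" using e by auto
  finally have dq: "dist ?m q < min e 1" .
  obtain t where t: "t \<in> T" "q \<in> t"
    using T unfolding plane_triangulation_def by blast
  have "t \<notin> F" using dq e t by (auto simp: subset_iff)
  moreover have "q \<in> t \<inter> cball ?m 1" using dq t by auto
  ultimately have "?m \<in> t" using t by (auto simp: F_def)
  moreover have "side (a, b) q > 0"
    using d y by (simp add: q_def side_affine midpoint_sides)
  ultimately show thesis using that t by blast
qed

text \<open>The face \<open>s\<close> that supplies the edge may lie on the right. A face
  \<open>t\<close> reaching the left side at the midpoint then meets \<open>s\<close> in a point
  that is no vertex of \<open>s\<close>, hence along an edge, and this edge is
  \<open>a b\<close>.\<close>

lemma half_edge_left_triangle:
  assumes T: "plane_triangulation T" and lf: "locally_finite T" and e: "(a, b) \<in> half_edges T"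
  obtains c where "side (a, b) c > 0" "convex hull {a, b, c} \<in> T"
proof -
  have tri: "closed_triangle t" if "t \<in> T" for t
    using T that by (simp add: plane_triangulation_def)
  obtain s where s: "s \<in> T" "closed_segment a b edge_of s"
    using e by (auto simp: half_edges_def edges_def)
  obtain z where z: "side (a, b) z \<noteq> 0" "s = convex hull {a, b, z}"
    using triangle_with_edge[OF tri[OF s(1)] s(2)] .
  show thesis
  proof (cases "side (a, b) z > 0")
    case True
    then show ?thesis using that z s by blast
  next
    case False
    let ?m = "midpoint a b"
    have ab: "a \<noteq> b" using z by (auto simp: side_def)
    have neg: "side (a, b) x \<le> 0" if "side (a, b) z' < 0" "x \<in> convex hull {a, b, z'}" for x z'
      using that triangle_side_nonneg[of b a z' x]
      by (auto simp: side_swap[of b a] insert_commute strictly_right_def)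
    \<comment> \<open>Reflecting \<open>z\<close> in the midpoint gives a point strictly on the
      left.\<close>
    have "side (a, b) (?m + (-1) *\<^sub>R (z - ?m)) > 0"
      unfolding side_affine using False z by (simp add: midpoint_sides)
    then obtain t q where t: "t \<in> T" "?m \<in> t" "q \<in> t" "side (a, b) q > 0"
      using triangle_across_midpoint[OF T lf] by blast
    have "q \<notin> s" using neg[of z q] z False t by auto
    then have "s \<noteq> t" using t by blast
    have mo: "?m \<in> open_segment a b" using ab by (simp add: midpoint_in_open_segment)
    have ins: "a \<in> s" "b \<in> s" using z by (auto simp: hull_inc)
    have "?m \<in> s"
      using z triangle_edges_subset(1)[of a b z] midpoint_in_closed_segment by blast
    then have "?m \<in> s \<inter> t" using t by blast
    moreover have "\<not> ?m extreme_point_of s"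
      using mo ins unfolding extreme_point_of_def by blast
    ultimately have st: "(s \<inter> t) edge_of s" "(s \<inter> t) edge_of t"
      using T s t \<open>s \<noteq> t\<close> unfolding plane_triangulation_def edge_to_edge_def
      by (metis emptyE singletonD)+
    \<comment> \<open>A face of \<open>s\<close> that contains an inner point of a segment in
      \<open>s\<close> contains both end points.\<close>
    then have "a \<in> s \<inter> t" "b \<in> s \<inter> t"
      using mo ins \<open>?m \<in> s \<inter> t\<close> unfolding edge_of_def face_of_def by blast+
    moreover have "convex (s \<inter> t)" using st face_of_imp_convex by (auto simp: edge_of_def)
    ultimately have "closed_segment a b \<subseteq> s \<inter> t" by (rule closed_segment_subset)
    then have "s \<inter> t = closed_segment a b" by (rule segment_edge_unique[OF s(2) st(1)])
    then have "closed_segment a b edge_of t" using st by simp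
    then obtain c where c: "side (a, b) c \<noteq> 0" "t = convex hull {a, b, c}"
      using triangle_with_edge[OF tri[OF t(1)]] by blast
    then have "side (a, b) c > 0" using neg[of c q] t by force
    then show ?thesis using that c t by blast
  qed
qed

section \<open>Successor and predecessor of a half-edge\<close>

lemma triangle_half_edge:
  assumes "convex hull {a, b, c} \<in> T" "side (a, b) c \<noteq> 0"
  shows "(a, b) \<in> half_edges T"
  using assms segment_edge_of_triangle by (auto simp: half_edges_def edges_def)

lemma inv_he_half_edges: "e \<in> half_edges T \<Longrightarrow> inv_he e \<in> half_edges T"
  by (simp add: half_edges_def inv_he_def closed_segment_commute)

lemma triangle_rotate: "convex hull {b, c, a} = convex hull {a, b, c}"
  by (simp add: insert_commute)

text \<open>A reversed side would have the opposite vertex strictly on its right. This gives the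
  uniqueness behind \<open>next_he\<close> and \<open>prev_he\<close>.\<close>

lemma half_edge_of_face:
  assumes T: "plane_triangulation T" and lf: "locally_finite T"
    and s: "convex hull {a, b, c} \<in> T" "side (a, b) c > 0"
    and h: "(x, y) \<in> half_edges T" "face_he T (x, y) = convex hull {a, b, c}"
  shows "(x, y) \<in> {(a, b), (b, c), (c, a)}"
proof -
  obtain z where z: "side (x, y) z > 0" "convex hull {x, y, z} \<in> T"
    using half_edge_left_triangle[OF T lf h(1)] .
  then have eq: "convex hull {x, y, z} = convex hull {a, b, c}"
    using face_he_eq[OF T] h by simp
  then have "closed_segment x y edge_of convex hull {a, b, c}"
    using segment_edge_of_triangle z by (metis less_irrefl)
  then have "closed_segment x y \<in> {closed_segment a b, closed_segment b c, closed_segment c a}"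
    using edge_of_triangle_iff[of a b c] s by (simp add: collinear_iff_side)
  moreover have "side (x, y) a \<ge> 0" "side (x, y) b \<ge> 0" "side (x, y) c \<ge> 0"
    using triangle_side_nonneg[OF z(1)] unfolding eq
    by (simp_all add: hull_inc strictly_right_def not_less)
  ultimately show ?thesis
    using s side_swap[of b a c] side_swap[of c b a] side_swap[of a c b]
      side_rotate[of b c a] side_rotate[of c a b]
    by (auto simp: doubleton_eq_iff)
qed

lemma next_he_eq:
  assumes T: "plane_triangulation T" and lf: "locally_finite T"
    and s: "convex hull {a, b, c} \<in> T" "side (a, b) c > 0"
  shows "next_he T (a, b) = (b, c)"
  unfolding next_he_def
proof (rule the_equality)
  have s': "convex hull {b, c, a} \<in> T" "side (b, c) a > 0"
    using s by (simp_all only: triangle_rotate side_rotate)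
  have f: "face_he T (a, b) = convex hull {a, b, c}" by (rule face_he_eq[OF T s])
  show "(b, c) \<in> half_edges T \<and> face_he T (b, c) = face_he T (a, b) \<and> fst (b, c) = snd (a, b)"
    using face_he_eq[OF T s'] f triangle_half_edge[OF s'(1)] s' by (simp add: triangle_rotate)
  fix h assume "h \<in> half_edges T \<and> face_he T h = face_he T (a, b) \<and> fst h = snd (a, b)"
  then show "h = (b, c)"
    using half_edge_of_face[OF T lf s, of "fst h" "snd h"] f s
    by (cases h) (auto simp: side_def)
qed

lemma prev_he_eq:
  assumes T: "plane_triangulation T" and lf: "locally_finite T"
    and s: "convex hull {a, b, c} \<in> T" "side (a, b) c > 0"
  shows "prev_he T (a, b) = (c, a)"
  unfolding prev_he_def
proof (rule the_equality)
  have s': "convex hull {c, a, b} \<in> T" "side (c, a) b > 0"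
    using s by (simp_all only: triangle_rotate[of c a b] side_rotate[of c a b])
      (simp_all only: triangle_rotate side_rotate)
  have f: "face_he T (a, b) = convex hull {a, b, c}" by (rule face_he_eq[OF T s])
  show "(c, a) \<in> half_edges T \<and> face_he T (c, a) = face_he T (a, b) \<and> snd (c, a) = fst (a, b)"
    using face_he_eq[OF T s'] f triangle_half_edge[OF s'(1)] s' by (simp add: triangle_rotate[of a b c])
  fix h assume "h \<in> half_edges T \<and> face_he T h = face_he T (a, b) \<and> snd h = fst (a, b)"
  then show "h = (c, a)"
    using half_edge_of_face[OF T lf s, of "fst h" "snd h"] f s
    by (cases h) (auto simp: side_def)
qed

section \<open>Local finiteness and termination of the walk\<close>

lemma finite_half_edges_near:
  assumes "locally_finite T"
  shows "finite {e \<in> half_edges T. closed_segment (fst e) (snd e) \<inter> cball p r \<noteq> {}}"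
proof (rule finite_subset)
  let ?S = "{s \<in> edges T. s \<inter> cball p r \<noteq> {}}"
  show "{e \<in> half_edges T. closed_segment (fst e) (snd e) \<inter> cball p r \<noteq> {}} \<subseteq>
      (\<Union>s\<in>?S. {e. closed_segment (fst e) (snd e) = s})"
    by (auto simp: half_edges_def)
  \<comment> \<open>Local finiteness counts edges as sets; a segment determines its end points up to
    order, so it carries at most two half-edges.\<close>
  have "finite {e. closed_segment (fst e) (snd e) = s}" for s :: "point set"
  proof (cases "\<exists>a b. closed_segment a b = s")
    case True
    then obtain a b where "closed_segment a b = s" by blast
    then have "{e. closed_segment (fst e) (snd e) = s} \<subseteq> {(a, b), (b, a)}"
      by (auto simp: doubleton_eq_iff)
    then show ?thesis using finite_subset by blast
  next
    case False
    then have "{e. closed_segment (fst e) (snd e) = s} = {}" by auto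
    then show ?thesis by simp
  qed
  then show "finite (\<Union>s\<in>?S. {e. closed_segment (fst e) (snd e) = s})"
    using assms by (auto simp: locally_finite_def)
qed

lemma walk_step_invariant:
  assumes T: "plane_triangulation T" and lf: "locally_finite T"
    and e: "e \<in> half_edges T" "side e p \<ge> 0" and p: "p \<notin> face_he T e"
    and step: "walk_step T p e e'"
  shows "e' \<in> half_edges T \<and> side e' p \<ge> 0 \<and> od_less (od e' p) (od e p)"
proof -
  obtain a b where ab: "e = (a, b)" by (cases e)
  obtain c where c: "side (a, b) c > 0" "convex hull {a, b, c} \<in> T"
    using half_edge_left_triangle[OF T lf] e ab by blast
  have pt: "p \<notin> convex hull {a, b, c}" using p face_he_eq[OF T c(2,1)] ab by simp
  have step': "if od_less (od (c, b) p) (od (a, c) p) then e' = (c, b)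
      else if od_less (od (a, c) p) (od (c, b) p) then e' = (a, c) else e' = (c, b) \<or> e' = (a, c)"
    using step unfolding walk_step_def ab next_he_eq[OF T lf c(2,1)] prev_he_eq[OF T lf c(2,1)]
    by (simp add: inv_he_def Let_def)
  have c': "convex hull {b, c, a} \<in> T" "side (b, c) a > 0"
    "convex hull {c, a, b} \<in> T" "side (c, a) b > 0"
    using c by (simp_all add: insert_commute side_rotate[of b c a] side_rotate[of c a b])
  have "(c, b) \<in> half_edges T" "(a, c) \<in> half_edges T"
    using inv_he_half_edges triangle_half_edge c' by (fastforce simp: inv_he_def)+
  then have he: "e' \<in> half_edges T" using step' by (auto split: if_splits)
  have p0: "side (a, b) p \<ge> 0" using e ab by simp
  have neg: "side (b, c) p < 0 \<or> side (c, a) p < 0"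
    using pt p0 mem_triangle_iff[OF c(1)] by force
  have l: "od_less (od (c, b) p) (od (a, c) p)" if "side (c, a) p > 0"
    using od_less_crossed[OF c(1)] that neg p0 by (force simp: od_commute[of c b] od_commute[of a c])
  have r: "od_less (od (a, c) p) (od (c, b) p)" if "side (b, c) p > 0"
    using od_less_crossed'[OF c(1)] that neg p0 by (force simp: od_commute[of c b] od_commute[of a c])
  have "e' = (c, b)" if "side (c, a) p > 0"
    using l[OF that] step' by simp
  moreover have "e' = (a, c)" if "side (b, c) p > 0"
    using r[OF that] step' by (auto simp: od_less_def)
  moreover have "e' = (c, b) \<or> e' = (a, c)"
    using step' by (auto split: if_splits)
  moreover have "b \<noteq> a" using c by (auto simp: side_def)
  \<comment> \<open>By contraposition: the choice \<open>(c, b)\<close> excludes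
    \<open>side (b, c) p > 0\<close>, and \<open>(a, c)\<close> excludes
    \<open>side (c, a) p > 0\<close>; \<open>b \<noteq> a\<close> keeps the two choices
    apart.\<close>
  ultimately have side: "side e' p \<ge> 0"
    by (metis neg_0_le_iff_le not_le prod.inject side_swap)
  have "od_less (od e' p) (od e p)"
    using od_decreases[OF c(1) p0 pt] step' unfolding ab
    by (auto simp: od_less_def split: if_splits)
  with he side show ?thesis by blast
qed

theorem theorem1:
  fixes T :: "point set set" and p :: point and e_init :: half_edge
    and w :: "nat \<Rightarrow> half_edge"
  assumes "plane_triangulation T"
    and "locally_finite T"
    and "e_init \<in> half_edges T"
    and "walk_run T p e_init w"
  shows "\<exists>n. (\<forall>k<n. p \<notin> face_he T (w k)) \<and> w n \<in> half_edges T \<and> p \<in> face_he T (w n)"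
proof -
  have w0: "w 0 \<in> half_edges T \<and> side (w 0) p \<ge> 0"
    using assms inv_he_half_edges
    by (auto simp: walk_run_def walk_start_def strictly_right_def side_inv_he)
  have step: "w (Suc n) \<in> half_edges T \<and> side (w (Suc n)) p \<ge> 0 \<and> od_less (od (w (Suc n)) p) (od (w n) p)"
    if "w n \<in> half_edges T \<and> side (w n) p \<ge> 0" "\<forall>k\<le>n. p \<notin> face_he T (w k)" for n
    using that assms(4) walk_step_invariant[OF assms(1,2)] unfolding walk_run_def by blast
  \<comment> \<open>Strict \<open>k < n\<close>: the invariant also covers the half-edge at which
    the loop stops, while later entries of \<open>w\<close> are unconstrained.\<close>
  have inv: "w n \<in> half_edges T \<and> side (w n) p \<ge> 0" if "\<forall>k<n. p \<notin> face_he T (w k)" for n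
    using that
  proof (induction n)
    case 0
    then show ?case using w0 by blast
  next
    case (Suc n)
    then show ?case using step[of n] by (simp add: less_Suc_eq_le)
  qed
  have "\<exists>n. p \<in> face_he T (w n)"
  proof (rule ccontr)
    assume never: "\<nexists>n. p \<in> face_he T (w n)"
    have he: "w n \<in> half_edges T" for n using inv never by blast
    have less: "od_less (od (w (Suc n)) p) (od (w n) p)" for n using step inv never by blast
    have desc: "od_less (od (w n) p) (od (w m) p)" if "m < n" for m n
      using that by (induction rule: less_Suc_induct) (use less od_less_trans in blast)+
    have "inj w"
      by (rule linorder_injI) (use desc in \<open>force simp: od_less_def\<close>)
    \<comment> \<open>The initial distance bounds all later ones, because the first component never
      increases.\<close>
    let ?d = "fst (od (w 0) p)"
    have "w n \<in> {e \<in> half_edges T. closed_segment (fst e) (snd e) \<inter> cball p ?d \<noteq> {}}" for n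
    proof -
      have "fst (od (w n) p) \<le> ?d"
        using desc[of 0 n] by (cases "n = 0") (auto simp: od_less_def)
      moreover have "fst (od (w n) p) = dist p (closest_point (closed_segment (fst (w n)) (snd (w n))) p)"
        using fst_od[of "fst (w n)" "snd (w n)"] by simp
      ultimately show ?thesis using he closest_point_mem_segment by fastforce
    qed
    then have "finite (range w)"
      by (intro finite_subset[OF _ finite_half_edges_near[OF assms(2)]] image_subsetI)
    then show False using \<open>inj w\<close> finite_imageD by blast
  qed
  then obtain n where "p \<in> face_he T (w n)" "\<forall>k<n. p \<notin> face_he T (w k)"
    using exists_least_iff[of "\<lambda>n. p \<in> face_he T (w n)"] by blast
  then show ?thesis using inv by blast
qed

end
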